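(* For every admissible augmented index $\tilde{\boldsymbol{k}}$ and every complex number $z$ with $|z|<1$, one has \[\widetilde{\mathrm{Li}}(\tilde{\boldsymbol{k}};z)=\widetilde{\mathrm{Li}}(\tilde{\boldsymbol{k}}^\dagger;z).\]
   Context: An augmented positive integer is a pair $\tilde{k}=(k,\mu)\in\mathbb{Z}_{>0}\times\{0,1\}$. An augmented index is a finite tuple $\tilde{\boldsymbol{k}}=\bigl((k_1,\mu_1),\ldots,(k_r,\mu_r)\bigr)$ ($r\ge 0$) of augmented positive integers; for $r=0$ it is written $\varnothing$. It is called admissible if $r=0$, or $r>0$ and $(k_r,\mu_r)\neq(1,1)$. Let $\mathcal{A}=\mathbb{Q}\langle e_0,e_1,e_z\rangle$ be the non-commutative polynomial algebra in three indeterminates, and put $x:=e_0$, $y_0:=-e_z$, $y_1:=e_z-e_1$ (so $\mathcal{A}$ is also the free algebra on $x,y_0,y_1$). For an augmented index put \[w(\tilde{\boldsymbol{k}}):=y_{\mu_1}x^{k_1-1}y_{\mu_2}x^{k_2-1}\cdots y_{\mu_r}x^{k_r-1}\in\mathcal{A},\qquad w(\varnothing):=1.\] Let $\tau:\mathcal{A}\to\mathcal{A}$ be the anti-automorphism of $\mathbb{Q}$-algebras with $\tau(e_0)=e_z-e_1$, $\tau(e_1)=e_z-e_0$, $\tau(e_z)=e_z$; equivalently, $\tau(x)=y_1$, $\tau(y_1)=x$, $\tau(y_0)=y_0$, and $\tau$ reverses the order of products. For an admissible augmented index $\tilde{\boldsymbol{k}}$, its dual $\tilde{\boldsymbol{k}}^\dagger$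 is the unique admissible augmented index with $\tau\bigl(w(\tilde{\boldsymbol{k}})\bigr)=w(\tilde{\boldsymbol{k}}^\dagger)$. For a non-empty admissible augmented index $\tilde{\boldsymbol{k}}=\bigl((k_1,\mu_1),\ldots,(k_r,\mu_r)\bigr)$ and $|z|<1$, define \[\widetilde{\mathrm{Li}}(\tilde{\boldsymbol{k}};z):=\sum_{0=m_0<m_1<\cdots<m_r}\ \prod_{i=1}^r\frac{\mu_i+(-1)^{\mu_i}z^{m_i-m_{i-1}}}{m_i^{k_i}},\] the sum being over integers $m_1,\ldots,m_r$, and set $\widetilde{\mathrm{Li}}(\varnothing;z):=1$. *)

theory Defs
  imports "HOL-Analysis.Analysis" "HOL-Library.Poly_Mapping"
begin

text \<open>
  The free algebra on \<open>e0, e1, ez\<close> is the monoid algebra over the rationals of the free monoid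
  on these letters. Since the convolution product of \<^type>\<open>poly_mapping\<close> is taken along the
  addition of the index type, concatenation of words is written as a (non-commutative) sum.
\<close>

datatype letter = E0 | E1 | Ez

datatype free_word = Word (letters: "letter list")

instantiation free_word :: monoid_add
begin

definition zero_free_word :: free_word
  where "0 = Word []"

definition plus_free_word :: "free_word \<Rightarrow> free_word \<Rightarrow> free_word"
  where "u + v = Word (letters u @ letters v)"

instance
  by standard (simp_all add: zero_free_word_def plus_free_word_def)

end

type_synonym nc_poly = "free_word \<Rightarrow>\<^sub>0 rat"

definition gen :: "letter \<Rightarrow> nc_poly"
  where "gen a = Poly_Mapping.single (Word [a]) 1"

definition scalar :: "rat \<Rightarrow> nc_poly"
  where "scalar c = Poly_Mapping.single 0 c"

definition gen_x :: nc_poly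
  where "gen_x = gen E0"

definition gen_y :: "nat \<Rightarrow> nc_poly"
  where "gen_y \<mu> = (if \<mu> = 0 then - gen Ez else gen Ez - gen E1)"

primrec tau_letter :: "letter \<Rightarrow> nc_poly" where
  "tau_letter E0 = gen Ez - gen E1"
| "tau_letter E1 = gen Ez - gen E0"
| "tau_letter Ez = gen Ez"

definition tau :: "nc_poly \<Rightarrow> nc_poly"
  where "tau p = (\<Sum>u\<in>Poly_Mapping.keys p.
           scalar (Poly_Mapping.lookup p u) * prod_list (map tau_letter (rev (letters u))))"

text \<open>The map \<^const>\<open>tau\<close> is indeed the anti-automorphism of algebras with the prescribed
  values on the generators.\<close>

lemma scalar_add: "scalar (a + b) = scalar a + scalar b"
  by (simp add: scalar_def single_add)

lemma scalar_mult: "scalar (a * b) = scalar a * scalar b"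
  by (simp add: scalar_def mult_single)

lemma scalar_zero [simp]: "scalar 0 = 0"
  by (simp add: scalar_def)

lemma scalar_one [simp]: "scalar 1 = 1"
  by (simp add: scalar_def)

lemma nc_poly_induct [case_names single add]:
  fixes p :: nc_poly
  assumes single: "\<And>u c. P (Poly_Mapping.single u c)"
    and add: "\<And>p q. P p \<Longrightarrow> P q \<Longrightarrow> P (p + q)"
  shows "P p"
proof (induction p rule: update_induct)
  case const
  show ?case
    using single[of 0 0] by simp
next
  case (update p u c)
  have "Poly_Mapping.update u c p = p + Poly_Mapping.single u c"
    using update(1)
    by (intro poly_mapping_eqI)
      (auto simp: lookup_update lookup_add lookup_single when_def in_keys_iff)
  then show ?case
    using update single add by simp
qed

lemma scalar_commute: "scalar c * p = p * scalar c"
  by (induction p rule: nc_poly_induct)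
    (simp_all add: scalar_def mult_single mult.commute distrib_left distrib_right)

lemma tau_single:
  "tau (Poly_Mapping.single u c) = scalar c * prod_list (map tau_letter (rev (letters u)))"
  by (cases "c = 0") (simp_all add: tau_def)

lemma tau_add: "tau (p + q) = tau p + tau q"
  unfolding tau_def
  by (rule setsum_keys_plus_distrib) (simp_all add: scalar_add distrib_right)

lemma tau_mult: "tau (p * q) = tau q * tau p"
proof (induction p rule: nc_poly_induct)
  case (single u c)
  show ?case
  proof (induction q rule: nc_poly_induct)
    case (single v d)
    let ?U = "prod_list (map tau_letter (rev (letters u)))"
    let ?V = "prod_list (map tau_letter (rev (letters v)))"
    have "tau (Poly_Mapping.single u c * Poly_Mapping.single v d) = scalar d * scalar c * (?V * ?U)"
      by (simp add: mult_single tau_single plus_free_word_def mult.commute flip: scalar_mult)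
    also have "\<dots> = scalar d * (scalar c * ?V) * ?U"
      by (simp only: mult.assoc)
    also have "\<dots> = (scalar d * ?V) * (scalar c * ?U)"
      by (simp only: scalar_commute[of c ?V] mult.assoc)
    finally show ?case
      by (simp add: tau_single)
  qed (simp add: tau_add distrib_left distrib_right)
qed (simp add: tau_add distrib_left distrib_right)

lemma tau_scalar: "tau (scalar c) = scalar c"
  by (simp add: scalar_def tau_single zero_free_word_def[symmetric] mult_single)
    (simp add: scalar_def zero_free_word_def)

lemma tau_gen: "tau (gen a) = tau_letter a"
  by (simp add: gen_def tau_single)

lemma tau_uminus: "tau (- p) = - tau p"
  by (metis add_eq_0_iff tau_add add.right_inverse scalar_zero tau_scalar)

lemma tau_diff: "tau (p - q) = tau p - tau q"
  by (metis diff_conv_add_uminus tau_add tau_uminus)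

lemma tau_gen_x: "tau gen_x = gen_y 1"
  by (simp add: gen_x_def gen_y_def tau_gen)

lemma tau_gen_y0: "tau (gen_y 0) = gen_y 0"
  by (simp add: gen_y_def tau_gen tau_uminus)

lemma tau_gen_y1: "tau (gen_y 1) = gen_x"
  by (simp add: gen_y_def gen_x_def tau_gen tau_diff)

lemma tau_tau: "tau (tau p) = p"
proof (induction p rule: nc_poly_induct)
  case (single u c)
  have *: "tau (tau (gen a)) = gen a" for a
    by (cases a) (simp_all add: tau_gen tau_diff)
  have "tau (tau (Poly_Mapping.single (Word as) 1)) = Poly_Mapping.single (Word as) 1" for as
  proof (induction as)
    case Nil
    show ?case
      using tau_scalar[of 1] by (simp add: scalar_def zero_free_word_def)
  next
    case (Cons a as)
    have "Poly_Mapping.single (Word (a # as)) 1 = gen a * Poly_Mapping.single (Word as) 1"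
      by (simp add: gen_def mult_single plus_free_word_def)
    then show ?case
      using Cons * by (simp add: tau_mult)
  qed
  moreover have "Poly_Mapping.single u c = scalar c * Poly_Mapping.single (Word (letters u)) 1"
    by (simp add: scalar_def mult_single)
  ultimately show ?case
    by (metis free_word.collapse scalar_commute tau_mult tau_scalar)
qed (simp add: tau_add)

type_synonym aug_index = "(nat \<times> nat) list"

definition is_aug_index :: "aug_index \<Rightarrow> bool"
  where "is_aug_index ks \<longleftrightarrow> (\<forall>(k, \<mu>) \<in> set ks. k > 0 \<and> \<mu> \<in> {0, 1})"

definition admissible :: "aug_index \<Rightarrow> bool"
  where "admissible ks \<longleftrightarrow> is_aug_index ks \<and> (ks = [] \<or> last ks \<noteq> (1, 1))"

definition index_word :: "aug_index \<Rightarrow> nc_poly"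
  where "index_word ks = prod_list (map (\<lambda>(k, \<mu>). gen_y \<mu> * gen_x ^ (k - 1)) ks)"

definition dual_index :: "aug_index \<Rightarrow> aug_index"
  where "dual_index ks = (THE ls. admissible ls \<and> tau (index_word ks) = index_word ls)"

text \<open>
  A summation index \<open>m\<^sub>1 < \<dots> < m\<^sub>r\<close> is a list \<open>ms\<close>, and \<open>(0 # ms) ! i\<close> is \<open>m\<^sub>i\<close> in the numbering
  that starts with \<open>m\<^sub>0 = 0\<close>; list positions \<open>i < r\<close> correspond to the factors \<open>i + 1\<close> of the product.
\<close>

definition summation_tuples :: "nat \<Rightarrow> nat list set"
  where "summation_tuples r = {ms. length ms = r \<and> sorted_wrt (<) (0 # ms)}"

definition Li_tilde :: "aug_index \<Rightarrow> complex \<Rightarrow> complex"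
  where "Li_tilde ks z =
    (\<Sum>\<^sub>\<infinity>ms\<in>summation_tuples (length ks).
       \<Prod>i<length ks.
         (of_nat (snd (ks ! i)) + (- 1) ^ snd (ks ! i) * z ^ ((0 # ms) ! Suc i - (0 # ms) ! i))
           / of_nat ((0 # ms) ! Suc i) ^ fst (ks ! i))"

lemma Li_tilde_Nil: "Li_tilde [] z = 1"
proof -
  have "summation_tuples 0 = {[]}"
    by (auto simp: summation_tuples_def)
  then show ?thesis
    by (simp add: Li_tilde_def)
qed

end

theory Submission
  imports Defs
begin

text \<open>
  For a word \<open>u\<close> in \<open>x, y\<^sub>0, y\<^sub>1\<close> let \<open>L\<^sub>u(s)\<close> be the power series obtained from the sum for \<open>u\<close> by
  the additional factor \<open>s\<close> to the power \<open>m\<^sub>r\<close>. Then \<open>L\<^bsub>ua\<^esub>' = \<omega>\<^sub>a L\<^sub>u\<close> with \<open>\<omega>\<^sub>x = 1/s\<close>, \<open>\<omega>\<^bsub>y\<^sub>0\<^esub> = z/(1 - zs)\<close> and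
  \<open>\<omega>\<^bsub>y\<^sub>1\<^esub> = 1/(1 - s) - z/(1 - zs)\<close>. The involution \<open>\<sigma>(t) = (1 - t)/(1 - zt)\<close> exchanges the end points of \<open>[0, 1]\<close>
  and pulls \<open>\<omega>\<^bsub>\<tau>(a)\<^esub>\<close> back to \<open>-\<omega>\<^sub>a\<close>. Hence \<open>\<Sum>\<^bsub>w = uv\<^esub> L\<^sub>u(t) L\<^bsub>\<tau>(v)\<^esub>(\<sigma>(t))\<close> has derivative \<open>0\<close> on \<open>(0, 1)\<close>:
  the two terms arising from each letter of \<open>w\<close> cancel. Its limit at \<open>1\<close> is the sum for \<open>w\<close>, its limit at \<open>0\<close> the
  sum for \<open>\<tau>(w)\<close>; the mixed terms vanish there because \<open>L\<^sub>u(s) = o(1/(1 - |s|))\<close>. Only real \<open>t\<close> are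
  needed even for complex \<open>z\<close>, since \<open>|\<sigma>(t)| < 1\<close> for \<open>0 < t < 1\<close>.
\<close>

section \<open>Coefficients and their growth\<close>

datatype xy = X | Y0 | Y1

text \<open>
  The generating series run over words in reversed order, so that \<open>coef \<phi> (rev w) m\<close> is the part with
  \<open>m\<^sub>r = m\<close> of the sum for \<open>w\<close>. Division by \<open>0\<close> gives the required value \<open>0\<close> at \<open>m = 0\<close>.
\<close>

primrec coef :: "(xy \<Rightarrow> nat \<Rightarrow> 'a::real_normed_field) \<Rightarrow> xy list \<Rightarrow> nat \<Rightarrow> 'a" where
  "coef \<phi> [] m = (if m = 0 then 1 else 0)"
| "coef \<phi> (a # w) m =
    (if a = X then coef \<phi> w m else \<Sum>j<m. coef \<phi> w j * \<phi> a (m - j)) / of_nat m"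

text \<open>For \<open>Y0\<close> and \<open>Y1\<close> these are the numerators \<mu> + (-1)^\<mu>
  z^k with \<mu> = 0 and \<mu> = 1.\<close>

fun weight :: "complex \<Rightarrow> xy \<Rightarrow> nat \<Rightarrow> complex" where
  "weight z X k = 0"
| "weight z Y0 k = z ^ k"
| "weight z Y1 k = 1 - z ^ k"

text \<open>The same recursion run with real weights: on words of indices it yields the sum of the
  norms of the summands, so it controls absolute convergence of the multiple sum and not only of the
  series in m.\<close>

definition abs_coef :: "complex \<Rightarrow> xy list \<Rightarrow> nat \<Rightarrow> real"
  where "abs_coef z = coef (\<lambda>a k. norm (weight z a k))"

lemma norm_coef_le: "norm (coef (weight z) w m) \<le> abs_coef z w m"
proof (induction w arbitrary: m)
  case (Cons a w)
  have "norm (\<Sum>j<m. coef (weight z) w j * weight z a (m - j))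
      \<le> (\<Sum>j<m. abs_coef z w j * norm (weight z a (m - j)))"
    by (rule order.trans[OF norm_sum]) (auto intro!: sum_mono mult_right_mono Cons simp: norm_mult)
  then show ?case
    using Cons by (auto simp: abs_coef_def norm_divide intro!: divide_right_mono)
qed (simp add: abs_coef_def)

lemma abs_coef_nonneg: "abs_coef z w m \<ge> 0"
  using norm_coef_le norm_ge_zero order.trans by blast

lemma coef_at_0 [simp]: "w \<noteq> [] \<Longrightarrow> coef \<phi> w 0 = 0"
  by (cases w) auto

text \<open>The sum telescopes: by the arithmetic-geometric mean inequality each term is at most 2
  sqrt(j + 1) - 2 sqrt(j).\<close>

lemma sum_inverse_sqrt_le: "(\<Sum>j<m. 1 / sqrt (real j + 1)) \<le> 2 * sqrt (real m)"
proof (induction m)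
  case (Suc m)
  have "2 * (sqrt (real m) * sqrt (real m + 1)) \<le> (sqrt (real m))\<^sup>2 + (sqrt (real m + 1))\<^sup>2"
    using sum_squares_bound[of "sqrt (real m)" "sqrt (real m + 1)"] by (simp add: mult.assoc)
  then have "2 * sqrt (real m) * sqrt (real m + 1) + 1 \<le> 2 * (sqrt (real m + 1) * sqrt (real m + 1))"
    by simp
  then have "2 * sqrt (real m) + 1 / sqrt (real m + 1) \<le> 2 * sqrt (real m + 1)"
    by (simp add: field_simps)
  with Suc show ?case
    by (simp add: add.commute)
qed simp

lemma norm_weight_le_2:
  assumes "norm z < 1"
  shows "norm (weight z a k) \<le> 2"
proof -
  have "norm (z ^ k) \<le> 1"
    using assms by (simp add: norm_power power_le_one)
  then show ?thesis
    using norm_triangle_ineq4[of 1 "z ^ k"] by (cases a) auto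
qed

text \<open>The true size may involve powers of log m over m. The exponent -1/2 absorbs the
  logarithms and is stable under every letter: summation yields O(sqrt m), and division by m
  restores 1/sqrt m.\<close>

lemma abs_coef_le_inverse_sqrt:
  assumes z: "norm z < 1"
  obtains A where "A \<ge> 0" "\<And>m. abs_coef z w m \<le> A / sqrt (real m + 1)"
proof -
  have "\<exists>A\<ge>0. \<forall>m. abs_coef z w m \<le> A / sqrt (real m + 1)"
  proof (induction w)
    case Nil
    show ?case
      by (rule exI[of _ 1]) (simp add: abs_coef_def)
  next
    case (Cons a w)
    then obtain A where A: "A \<ge> 0" "\<And>m. abs_coef z w m \<le> A / sqrt (real m + 1)"
      by blast
    \<comment> \<open>The 8 collects 2 from the weight, 2 from the sum of inverse square roots, and
      2 from passing from m to m + 1, as m + 1 <= 4 m.\<close>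
    have "abs_coef z (a # w) m \<le> 8 * A / sqrt (real m + 1)" for m
    proof (cases "m = 0 \<or> a = X")
      case True
      have "abs_coef z (a # w) m \<le> abs_coef z w m"
        using True abs_coef_nonneg[of z w m] mult_right_mono[of 1 "real m" "abs_coef z w m"]
        by (cases "m = 0") (auto simp: abs_coef_def divide_le_eq mult.commute)
      also have "\<dots> \<le> A / sqrt (real m + 1)" by (fact A)
      also have "\<dots> \<le> 8 * A / sqrt (real m + 1)"
        using A by (intro divide_right_mono) auto
      finally show ?thesis .
    next
      case False
      then have m: "m > 0" by simp
      have "(\<Sum>j<m. abs_coef z w j * norm (weight z a (m - j))) \<le> (\<Sum>j<m. A / sqrt (real j + 1) * 2)"
        using A norm_weight_le_2[OF z] abs_coef_nonneg by (intro sum_mono mult_mono) auto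
      also have "\<dots> = 2 * A * (\<Sum>j<m. 1 / sqrt (real j + 1))"
        by (simp add: sum_distrib_left mult_ac)
      also have "\<dots> \<le> 2 * A * (2 * sqrt (real m))"
        using A sum_inverse_sqrt_le by (intro mult_left_mono) auto
      finally have "abs_coef z (a # w) m \<le> 4 * A * sqrt (real m) / real m"
        using False by (auto simp: abs_coef_def intro!: divide_right_mono)
      also have "\<dots> = 4 * A / sqrt (real m)"
        using m by (simp add: field_simps)
      also have "\<dots> = 8 * A / sqrt (4 * real m)"
        by (simp add: real_sqrt_mult)
      also have "\<dots> \<le> 8 * A / sqrt (real m + 1)"
        using m A by (intro divide_left_mono) auto
      finally show ?thesis .
    qed
    then show ?case
      using A by (intro exI[of _ "8 * A"]) auto
  qed
  then show ?thesis
    using that by blast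
qed

lemma abs_coef_tendsto_0:
  assumes "norm z < 1"
  shows "abs_coef z w \<longlonglongrightarrow> 0"
proof -
  obtain A where A: "A \<ge> 0" "\<And>m. abs_coef z w m \<le> A / sqrt (real m + 1)"
    using abs_coef_le_inverse_sqrt[OF assms] by blast
  have "filterlim (\<lambda>m. sqrt (real m + 1)) at_top sequentially"
    by (intro filterlim_compose[OF sqrt_at_top] filterlim_at_top_mono[OF filterlim_real_sequentially]) auto
  then have "(\<lambda>m. A / sqrt (real m + 1)) \<longlonglongrightarrow> 0"
    by (intro tendsto_divide_0[OF tendsto_const] filterlim_at_top_imp_at_infinity)
  then show ?thesis
    by (rule Lim_null_comparison[rotated]) (use A abs_coef_nonneg in auto)
qed

lemma abs_coef_bounded:
  assumes "norm z < 1"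
  obtains B where "B > 0" "\<And>m. abs_coef z w m \<le> B"
proof -
  have "Bseq (abs_coef z w)"
    by (rule convergent_imp_Bseq) (use abs_coef_tendsto_0[OF assms] in \<open>auto simp: convergent_def\<close>)
  then obtain B where "B > 0" "\<And>m. norm (abs_coef z w m) \<le> B"
    by (auto simp: Bseq_def)
  then show ?thesis
    by (intro that) (auto dest: abs_le_D1)
qed

lemma summable_inverse_mult_sqrt: "summable (\<lambda>m. A / (real m * sqrt (real m + 1)))"
proof -
  have le: "norm (1 / (real m * sqrt (real m + 1))) \<le> real m powr (- 3 / 2)" for m
  proof (cases "m = 0")
    case False
    have "1 / (real m * sqrt (real m + 1)) \<le> 1 / (real m * sqrt (real m))"
      using False by (intro divide_left_mono mult_left_mono) auto
    also have "\<dots> = 1 / (real m powr 1 * real m powr (1 / 2))"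
      using False by (simp add: powr_half_sqrt)
    also have "\<dots> = real m powr (- 3 / 2)"
      by (subst powr_add[symmetric]) (simp add: powr_minus_divide)
    finally show ?thesis by simp
  qed auto
  have "summable (\<lambda>m. real m powr (- 3 / 2))"
    by (subst summable_real_powr_iff) simp
  then have "summable (\<lambda>m. 1 / (real m * sqrt (real m + 1)))"
    by (rule summable_comparison_test') (rule le)
  from summable_mult[OF this, of A] show ?thesis
    by simp
qed

text \<open>Words are reversed, so the condition on the head is admissibility. An outer X divides a
  sequence of order m^(-1/2) by m; for an outer Y0 the geometric weights keep the convolution of
  that order before the division.\<close>

lemma summable_abs_coef:
  assumes z: "norm z < 1" and w: "w = [] \<or> hd w \<noteq> Y1"
  shows "summable (abs_coef z w)"
proof (cases w)
  case Nil
  show ?thesis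
    by (rule summable_finite[of "{0}"]) (auto simp: Nil abs_coef_def)
next
  case (Cons a u)
  obtain A where A: "A \<ge> 0" "\<And>m. abs_coef z u m \<le> A / sqrt (real m + 1)"
    using abs_coef_le_inverse_sqrt[OF z] by blast
  have "\<exists>C. \<forall>m. (if a = X then abs_coef z u m else \<Sum>j<m. abs_coef z u j * norm (weight z a (m - j)))
                 \<le> C / sqrt (real m + 1)"
  proof (cases "a = X")
    case False
    then have a: "a = Y0"
      using w Cons by (cases a) auto
    \<comment> \<open>The factor k + 1 with k = m - j pays for replacing sqrt(j + 1) by sqrt(m + 1),
      because m + 1 <= (j + 1) (m - j + 1).\<close>
    let ?g = "\<lambda>k. (real k + 1) * norm z ^ k"
    have g: "summable ?g"
      using geometric_deriv_sums[of "norm z"] z by (simp add: sums_iff add.commute)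
    show ?thesis
    proof (intro exI allI)
      fix m
      have "(\<Sum>j<m. abs_coef z u j * norm (weight z a (m - j))) \<le> (\<Sum>j<m. A / sqrt (real m + 1) * ?g (m - j))"
      proof (rule sum_mono)
        fix j assume "j \<in> {..<m}"
        then have j: "j < m" by simp
        have "real m + 1 \<le> (real j + 1) * (real (m - j) + 1)"
          using j by (simp add: of_nat_diff algebra_simps)
            (metis le_add_same_cancel1 less_imp_le mult_left_mono of_nat_0_le_iff of_nat_le_iff of_nat_mult of_nat_add)
        also have "\<dots> \<le> (real j + 1) * (real (m - j) + 1)\<^sup>2"
          by (intro mult_left_mono) (auto simp: power2_eq_square)
        finally have "sqrt (real m + 1) \<le> sqrt (real j + 1) * (real (m - j) + 1)"
          by (metis abs_of_nonneg add_nonneg_nonneg of_nat_0_le_iff real_sqrt_abs real_sqrt_le_iff real_sqrt_mult zero_le_one)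
        then have "A / sqrt (real j + 1) \<le> A / sqrt (real m + 1) * (real (m - j) + 1)"
          using mult_left_mono[OF _ A(1), of "sqrt (real m + 1)" "sqrt (real j + 1) * (real (m - j) + 1)"]
          by (simp add: field_simps)
        then have "A / sqrt (real j + 1) * norm z ^ (m - j)
            \<le> A / sqrt (real m + 1) * (real (m - j) + 1) * norm z ^ (m - j)"
          by (rule mult_right_mono) auto
        then have "A / sqrt (real j + 1) * norm z ^ (m - j) \<le> A / sqrt (real m + 1) * ?g (m - j)"
          by (simp only: mult.assoc)
        moreover have "abs_coef z u j * norm (weight z a (m - j)) \<le> A / sqrt (real j + 1) * norm z ^ (m - j)"
          using mult_right_mono[OF A(2)[of j], of "norm z ^ (m - j)"] by (simp add: a norm_power)
        ultimately show "abs_coef z u j * norm (weight z a (m - j)) \<le> A / sqrt (real m + 1) * ?g (m - j)"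
          by linarith
      qed
      also have "\<dots> = A / sqrt (real m + 1) * (\<Sum>j<m. ?g (m - j))"
        by (simp add: sum_distrib_left)
      also have "(\<Sum>j<m. ?g (m - j)) = sum ?g {1..m}"
        by (rule sum.reindex_bij_witness[of _ "\<lambda>k. m - k" "\<lambda>j. m - j"]) auto
      also have "\<dots> \<le> suminf ?g"
        by (intro sum_le_suminf g) auto
      finally show "(if a = X then abs_coef z u m else \<Sum>j<m. abs_coef z u j * norm (weight z a (m - j)))
          \<le> (A * suminf ?g) / sqrt (real m + 1)"
        using A by (simp add: False mult_left_mono divide_right_mono)
    qed
  qed (use A in auto)
  then obtain C where C: "\<And>m. (if a = X then abs_coef z u m
      else \<Sum>j<m. abs_coef z u j * norm (weight z a (m - j))) \<le> C / sqrt (real m + 1)"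
    by blast
  have "abs_coef z w m \<le> C / (real m * sqrt (real m + 1))" for m
    using divide_right_mono[OF C[of m], of "real m"]
    by (simp add: Cons abs_coef_def mult.commute split: if_splits)
  then show ?thesis
    using abs_coef_nonneg
    by (intro summable_comparison_test'[OF summable_inverse_mult_sqrt[of C]]) auto
qed

section \<open>The generating series\<close>

definition polylog :: "complex \<Rightarrow> xy list \<Rightarrow> complex \<Rightarrow> complex"
  where "polylog z w s = suminf (\<lambda>m. coef (weight z) w m * s ^ m)"

lemma polylog_Nil [simp]: "polylog z [] = (\<lambda>s. 1)"
proof
  fix s
  have "polylog z [] s = (\<Sum>m\<in>{0}. coef (weight z) [] m * s ^ m)"
    unfolding polylog_def by (rule suminf_finite) auto
  then show "polylog z [] s = 1" by simp
qed

lemma summable_abs_coef_power: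
  assumes "norm z < 1" "0 \<le> r" "r < 1"
  shows "summable (\<lambda>m. abs_coef z w m * r ^ m)"
proof -
  obtain B where B: "B > 0" "\<And>m. abs_coef z w m \<le> B"
    using abs_coef_bounded[OF assms(1)] by blast
  have "summable (\<lambda>m. B * r ^ m)"
    using assms by (intro summable_mult summable_geometric) auto
  then show ?thesis
    by (rule summable_comparison_test') (use B assms abs_coef_nonneg in \<open>auto simp: abs_mult intro!: mult_right_mono\<close>)
qed

lemma norm_coef_power_le: "norm (coef (weight z) w m * s ^ m) \<le> abs_coef z w m * norm s ^ m"
  using norm_coef_le by (auto simp: norm_mult norm_power intro!: mult_right_mono)

lemma abs_summable_polylog:
  assumes "norm z < 1" "norm s < 1"
  shows "summable (\<lambda>m. norm (coef (weight z) w m * s ^ m))"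
  by (rule summable_comparison_test'[OF summable_abs_coef_power[of z "norm s" w]])
    (use assms norm_coef_power_le in auto)

lemma norm_polylog_le:
  assumes "norm z < 1" "norm s < 1"
  shows "norm (polylog z w s) \<le> suminf (\<lambda>m. abs_coef z w m * norm s ^ m)"
  unfolding polylog_def
  by (rule order.trans[OF summable_norm[OF abs_summable_polylog]])
    (use assms norm_coef_power_le in \<open>auto intro!: suminf_le abs_summable_polylog summable_abs_coef_power\<close>)

fun form :: "complex \<Rightarrow> xy \<Rightarrow> complex \<Rightarrow> complex" where
  "form z X s = 1 / s"
| "form z Y0 s = z / (1 - z * s)"
| "form z Y1 s = 1 / (1 - s) - z / (1 - z * s)"

text \<open>Consecutive summation indices differ by at least 1, hence the shift to
  \<open>Suc k\<close>. Absolute summability prepares the Cauchy product in the derivative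
  formula.\<close>

lemma weight_sums_form:
  assumes "norm z < 1" "norm s < 1" "a \<noteq> X"
  shows "(\<lambda>k. weight z a (Suc k) * s ^ k) sums form z a s"
    and "summable (\<lambda>k. norm (weight z a (Suc k) * s ^ k))"
proof -
  have "norm (z * s) < 1"
    using assms mult_strict_mono'[of "norm z" 1 "norm s" 1] by (simp add: norm_mult)
  then have 0: "(\<lambda>k. z * (z * s) ^ k) sums (z * (1 / (1 - z * s)))"
    by (intro sums_mult geometric_sums)
  moreover have "(\<lambda>k. s ^ k) sums (1 / (1 - s))"
    using assms by (intro geometric_sums)
  ultimately have 1: "(\<lambda>k. s ^ k - z * (z * s) ^ k) sums (1 / (1 - s) - z * (1 / (1 - z * s)))"
    by (intro sums_diff)
  show "(\<lambda>k. weight z a (Suc k) * s ^ k) sums form z a s"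
    using 0 1 assms(3) by (cases a) (simp_all add: power_mult_distrib algebra_simps)
  show "summable (\<lambda>k. norm (weight z a (Suc k) * s ^ k))"
  proof (rule summable_comparison_test')
    show "summable (\<lambda>k. 2 * norm s ^ k)"
      using assms by (intro summable_mult summable_geometric) auto
  qed (use norm_weight_le_2[OF assms(1)] in \<open>auto simp: norm_mult norm_power intro!: mult_right_mono\<close>)
qed

text \<open>Differentiation cancels the division by m in \<open>coef\<close>. This leaves the series
  of \<open>w\<close> over s for X, and its Cauchy product with the series of the form for Y0 and
  Y1. For X the constant term has to vanish, which the empty word violates.\<close>

lemma polylog_has_field_derivative:
  assumes z: "norm z < 1" and s: "norm s < 1" "s \<noteq> 0" and w: "a = X \<Longrightarrow> w \<noteq> []"
  shows "(polylog z (a # w) has_field_derivative form z a s * polylog z w s) (at s)"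
proof -
  let ?c = "coef (weight z)"
  have "summable (\<lambda>n. ?c (a # w) n * t ^ n)" if "norm t < 1" for t
    using abs_summable_polylog[OF z that] by (rule summable_norm_cancel)
  then have deriv: "(polylog z (a # w) has_field_derivative suminf (\<lambda>n. diffs (?c (a # w)) n * s ^ n)) (at s)"
    unfolding polylog_def
    by (rule termdiffs_strong'[OF _ s(1)])
  have "(\<lambda>n. diffs (?c (a # w)) n * s ^ n) sums (form z a s * polylog z w s)"
  proof (cases "a = X")
    case True
    have "(\<lambda>n. ?c w n * s ^ n) sums polylog z w s"
      unfolding polylog_def
      by (rule summable_sums[OF summable_norm_cancel[OF abs_summable_polylog[OF z s(1)]]])
    then have "(\<lambda>n. ?c w (Suc n) * s ^ Suc n) sums polylog z w s"
      using sums_Suc_iff[of "\<lambda>n. ?c w n * s ^ n" "polylog z w s"] w True by simp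
    then have "(\<lambda>n. (1 / s) * (?c w (Suc n) * s ^ Suc n)) sums ((1 / s) * polylog z w s)"
      by (rule sums_mult)
    also have "(\<lambda>n. (1 / s) * (?c w (Suc n) * s ^ Suc n)) = (\<lambda>n. diffs (?c (a # w)) n * s ^ n)"
      using s by (intro ext) (simp add: diffs_def True del: of_nat_Suc)
    finally show ?thesis
      by (simp add: True)
  next
    case False
    have "(\<lambda>n. \<Sum>j\<le>n. (?c w j * s ^ j) * (weight z a (Suc (n - j)) * s ^ (n - j)))
        sums (polylog z w s * form z a s)"
      using Cauchy_product_sums[OF abs_summable_polylog[OF z s(1)] weight_sums_form(2)[OF z s(1) False]]
        weight_sums_form(1)[OF z s(1) False]
      by (simp add: polylog_def sums_iff)
    also have "(\<lambda>n. \<Sum>j\<le>n. (?c w j * s ^ j) * (weight z a (Suc (n - j)) * s ^ (n - j)))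
        = (\<lambda>n. diffs (?c (a # w)) n * s ^ n)"
    proof (rule ext)
      fix n
      have "(\<Sum>j\<le>n. (?c w j * s ^ j) * (weight z a (Suc (n - j)) * s ^ (n - j)))
          = (\<Sum>j\<le>n. ?c w j * weight z a (Suc n - j) * s ^ n)"
        by (rule sum.cong) (auto simp: Suc_diff_le mult_ac simp flip: power_add)
      also have "\<dots> = diffs (?c (a # w)) n * s ^ n"
        using False by (simp add: diffs_def sum_distrib_right lessThan_Suc_atMost del: of_nat_Suc)
      finally show "(\<Sum>j\<le>n. (?c w j * s ^ j) * (weight z a (Suc (n - j)) * s ^ (n - j)))
          = diffs (?c (a # w)) n * s ^ n" .
    qed
    finally show ?thesis
      by (simp add: mult.commute)
  qed
  then show ?thesis
    using deriv by (simp add: sums_iff)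
qed


section \<open>Boundary behaviour of the generating series\<close>

text \<open>For admissible words \<open>abs_coef\<close> is a summable majorant on the closed disc,
  so the series is continuous up to s = 1. The general path \<open>p\<close> covers both the real
  parameter and its image under the involution.\<close>

lemma polylog_tendsto:
  assumes z: "norm z < 1" and w: "w = [] \<or> hd w \<noteq> Y1"
    and p: "(p \<longlongrightarrow> 1) F" "\<forall>\<^sub>F t in F. norm (p t) < 1"
  shows "((\<lambda>t. polylog z w (p t)) \<longlongrightarrow> polylog z w 1) F"
proof -
  have "uniform_limit (cball 0 1) (\<lambda>n s. \<Sum>m<n. coef (weight z) w m * s ^ m) (polylog z w) sequentially"
    unfolding polylog_def
  proof (rule Weierstrass_m_test[OF _ summable_abs_coef[OF z w]])
    fix m s assume "s \<in> cball (0 :: complex) 1"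
    then have "abs_coef z w m * norm s ^ m \<le> abs_coef z w m * 1"
      using abs_coef_nonneg by (intro mult_left_mono power_le_one) auto
    then show "norm (coef (weight z) w m * s ^ m) \<le> abs_coef z w m"
      using norm_coef_power_le[of z w m s] by simp
  qed
  then have "continuous_on (cball 0 1) (polylog z w)"
    by (rule uniform_limit_theorem[rotated]) (auto intro!: always_eventually continuous_intros)
  then show ?thesis
    by (rule continuous_on_tendsto_compose)
      (use p in \<open>auto elim: eventually_mono\<close>)
qed

text \<open>This is \<open>polylog z w s\<close> = o(1/(1 - |s|)), multiplied out. The coefficients
  tend to 0: the first M contribute a bounded amount, the others at most \<epsilon> times a
  geometric series.\<close>

lemma polylog_growth:
  assumes z: "norm z < 1" and "\<epsilon> > 0"
  obtains C where "\<And>s. norm s < 1 \<Longrightarrow> norm (polylog z w s) * (1 - norm s) \<le> C * (1 - norm s) + \<epsilon>"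
proof -
  obtain B where B: "B > 0" "\<And>m. abs_coef z w m \<le> B"
    using abs_coef_bounded[OF z] by blast
  obtain M where M: "\<And>m. m \<ge> M \<Longrightarrow> abs_coef z w m < \<epsilon>"
    using order_tendstoD(2)[OF abs_coef_tendsto_0[OF z] \<open>\<epsilon> > 0\<close>]
    by (auto simp: eventually_at_top_linorder)
  have "norm (polylog z w s) * (1 - norm s) \<le> (real M * B) * (1 - norm s) + \<epsilon>" if s: "norm s < 1" for s
  proof -
    let ?h = "\<lambda>m. if m < M then B else 0"
    have h: "?h sums (\<Sum>m<M. ?h m)"
      by (rule sums_finite) auto
    have g: "(\<lambda>m. \<epsilon> * norm s ^ m) sums (\<epsilon> * (1 / (1 - norm s)))"
      using s by (intro sums_mult geometric_sums) auto
    have le: "abs_coef z w m * norm s ^ m \<le> ?h m + \<epsilon> * norm s ^ m" for m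
    proof (cases "m < M")
      case True
      have "abs_coef z w m * norm s ^ m \<le> B * 1"
        using B abs_coef_nonneg s by (intro mult_mono power_le_one) auto
      moreover have "0 \<le> \<epsilon> * norm s ^ m"
        using \<open>\<epsilon> > 0\<close> by simp
      ultimately show ?thesis
        using True by simp
    next
      case False
      then show ?thesis
        using M[of m] by (auto intro!: mult_right_mono)
    qed
    have "norm (polylog z w s) \<le> suminf (\<lambda>m. abs_coef z w m * norm s ^ m)"
      by (rule norm_polylog_le[OF z s])
    also have "\<dots> \<le> (\<Sum>m<M. ?h m) + \<epsilon> * (1 / (1 - norm s))"
      using sums_le[OF le _ sums_add[OF h g]] summable_abs_coef_power[OF z _ s, of w]
      by (simp add: summable_sums)
    also have "(\<Sum>m<M. ?h m) = real M * B"
      by simp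
    finally show ?thesis
      using s by (simp add: field_simps)
  qed
  then show ?thesis
    by (rule that)
qed

text \<open>The constant term of a non-empty word is 0, so a factor \<open>norm s\<close> splits
  off; the radius 1/2 bounds the remaining series uniformly.\<close>

lemma norm_polylog_le_linear:
  assumes z: "norm z < 1" and w: "w \<noteq> []"
  obtains K where "K \<ge> 0" "\<And>s. norm s \<le> 1 / 2 \<Longrightarrow> norm (polylog z w s) \<le> K * norm s"
proof -
  let ?g = "\<lambda>m. abs_coef z w m * (1 / 2) ^ m"
  have g: "summable ?g"
    by (rule summable_abs_coef_power[OF z]) auto
  show ?thesis
  proof (rule that)
    show "2 * suminf ?g \<ge> 0"
      using abs_coef_nonneg by (intro mult_nonneg_nonneg suminf_nonneg g) auto
    fix s :: complex assume s: "norm s \<le> 1 / 2"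
    have "abs_coef z w m * norm s ^ m \<le> (2 * norm s) * ?g m" for m
    proof (cases m)
      case (Suc n)
      have "norm s ^ n \<le> (1 / 2) ^ n"
        using s by (intro power_mono) auto
      then have "(abs_coef z w m * norm s) * norm s ^ n \<le> (abs_coef z w m * norm s) * (1 / 2) ^ n"
        using abs_coef_nonneg by (intro mult_left_mono) auto
      then show ?thesis
        by (simp add: Suc mult_ac)
    qed (use w in \<open>simp add: abs_coef_def\<close>)
    then have "suminf (\<lambda>m. abs_coef z w m * norm s ^ m) \<le> suminf (\<lambda>m. (2 * norm s) * ?g m)"
      using s by (intro suminf_le summable_mult g summable_abs_coef_power[OF z]) auto
    also have "\<dots> = (2 * norm s) * suminf ?g"
      by (rule suminf_mult[OF g])
    finally show "norm (polylog z w s) \<le> 2 * suminf ?g * norm s"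
      using norm_polylog_le[OF z, of s w] s by (simp add: mult_ac)
  qed
qed

text \<open>The first factor may blow up at 1, but more slowly than 1/(1 - |p|), while the second
  vanishes at least linearly in |q|, which is O(1 - |p|).\<close>

lemma polylog_mult_tendsto_0:
  assumes z: "norm z < 1" and v: "v \<noteq> []"
    and p: "(p \<longlongrightarrow> 1) F" "\<forall>\<^sub>F t in F. norm (p t) < 1"
    and q: "\<forall>\<^sub>F t in F. norm (q t) \<le> K * (1 - norm (p t))"
  shows "((\<lambda>t. polylog z u (p t) * polylog z v (q t)) \<longlongrightarrow> 0) F"
proof -
  have lim: "((\<lambda>t. C * (1 - norm (p t)) + e) \<longlongrightarrow> e) F" for C e
    using p(1) by (auto intro!: tendsto_eq_intros)
  obtain K' where K': "K' \<ge> 0" "\<And>s. norm s \<le> 1 / 2 \<Longrightarrow> norm (polylog z v s) \<le> K' * norm s"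
    using norm_polylog_le_linear[OF z v] by blast
  have "((\<lambda>t. norm (polylog z u (p t)) * (1 - norm (p t))) \<longlongrightarrow> 0) F"
  proof (rule order_tendstoI)
    fix e :: real assume "e < 0"
    show "\<forall>\<^sub>F t in F. e < norm (polylog z u (p t)) * (1 - norm (p t))"
      using p(2)
    proof eventually_elim
      case (elim t)
      then have "0 \<le> norm (polylog z u (p t)) * (1 - norm (p t))"
        by simp
      with \<open>e < 0\<close> show ?case by linarith
    qed
  next
    fix e :: real assume "e > 0"
    then obtain C where C: "\<And>s. norm s < 1 \<Longrightarrow>
        norm (polylog z u s) * (1 - norm s) \<le> C * (1 - norm s) + e / 2"
      using polylog_growth[OF z, of "e / 2"] by (metis half_gt_zero)
    have "\<forall>\<^sub>F t in F. C * (1 - norm (p t)) + e / 2 < e"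
      using \<open>e > 0\<close> by (intro order_tendstoD(2)[OF lim]) auto
    then show "\<forall>\<^sub>F t in F. norm (polylog z u (p t)) * (1 - norm (p t)) < e"
      using p(2) by eventually_elim (use C in force)
  qed
  then have *: "((\<lambda>t. K' * K * (norm (polylog z u (p t)) * (1 - norm (p t)))) \<longlongrightarrow> 0) F"
    by (rule tendsto_mult_right_zero)
  have "\<forall>\<^sub>F t in F. K * (1 - norm (p t)) < 1 / 2"
    using order_tendstoD(2)[OF lim[of K 0], of "1 / 2"] by simp
  then have "\<forall>\<^sub>F t in F. norm (polylog z u (p t) * polylog z v (q t))
      \<le> K' * K * (norm (polylog z u (p t)) * (1 - norm (p t)))"
    using q
  proof eventually_elim
    case (elim t)
    then have "norm (polylog z v (q t)) \<le> K' * norm (q t)"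
      by (intro K') auto
    also have "\<dots> \<le> K' * (K * (1 - norm (p t)))"
      using K' elim by (intro mult_left_mono) auto
    finally have "norm (polylog z u (p t)) * norm (polylog z v (q t))
        \<le> norm (polylog z u (p t)) * (K' * (K * (1 - norm (p t))))"
      by (intro mult_left_mono) auto
    then show ?case
      by (simp add: norm_mult mult_ac)
  qed
  then show ?thesis
    by (rule Lim_null_comparison[OF _ *])
qed

section \<open>Duality for words\<close>

primrec swap :: "xy \<Rightarrow> xy" where
  "swap X = Y1"
| "swap Y0 = Y0"
| "swap Y1 = X"

text \<open>For z different from 0 this Moebius map also exchanges 1/z and infinity, so it permutes
  all the poles of the forms.\<close>

definition involution :: "complex \<Rightarrow> complex \<Rightarrow> complex"
  where "involution z t = (1 - t) / (1 - z * t)"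

text \<open>Everything follows from |1 - z t| >= 1 - |z| t. The two bounds are the comparisons
  between the arguments of the two series that are used at t = 1 and at t = 0 respectively.\<close>

lemma
  assumes z: "norm z < 1" and t: "0 < t" "t < 1"
  shows involution_bounds: "norm (involution z (of_real t)) \<le> 1 / (1 - norm z) * (1 - t)"
      "t \<le> 1 / (1 - norm z) * (1 - norm (involution z (of_real t)))"
    and norm_involution_less_1: "norm (involution z (of_real t)) < 1"
    and involution_denom_nonzero: "1 - z * of_real t \<noteq> 0"
proof -
  have "norm z * t < 1"
    using assms mult_strict_mono'[of "norm z" 1 t 1] by simp
  have "1 - norm z * t \<le> norm (1 - z * of_real t)"
    using norm_triangle_ineq2[of 1 "z * of_real t"] t by (simp add: norm_mult)
  then show "1 - z * of_real t \<noteq> 0"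
    using \<open>norm z * t < 1\<close> by auto
  have "norm (1 - complex_of_real t) = 1 - t"
    using t by (metis abs_of_pos diff_gt_0_iff_gt norm_of_real of_real_1 of_real_diff)
  then have le: "norm (involution z (of_real t)) \<le> (1 - t) / (1 - norm z * t)"
    using \<open>1 - norm z * t \<le> _\<close> \<open>norm z * t < 1\<close> t
    unfolding involution_def norm_divide by (auto intro!: divide_left_mono mult_pos_pos)
  have "norm z * t \<le> norm z"
    using t by (simp add: mult_left_le)
  then have "(1 - t) / (1 - norm z * t) \<le> (1 - t) / (1 - norm z)"
    using z t by (intro divide_left_mono mult_pos_pos) auto
  with le show "norm (involution z (of_real t)) \<le> 1 / (1 - norm z) * (1 - t)"
    by simp
  have "1 - (1 - t) / (1 - norm z * t) = (1 - norm z) * t / (1 - norm z * t)"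
    using \<open>norm z * t < 1\<close> by (simp add: field_simps)
  also have "\<dots> \<ge> (1 - norm z) * t / 1"
    using \<open>norm z * t < 1\<close> z t by (intro divide_left_mono) auto
  finally have "(1 - norm z) * t \<le> 1 - norm (involution z (of_real t))"
    using le by simp
  then show "t \<le> 1 / (1 - norm z) * (1 - norm (involution z (of_real t)))"
    using z by (simp add: field_simps)
  moreover have "0 < (1 - norm z) * t"
    using z t by simp
  ultimately show "norm (involution z (of_real t)) < 1"
    using \<open>(1 - norm z) * t \<le> _\<close> by linarith
qed

lemma involution_has_field_derivative:
  assumes "1 - z * t \<noteq> 0"
  shows "(involution z has_field_derivative - (1 - z) / (1 - z * t)\<^sup>2) (at t)"
  unfolding involution_def using assms
  by (auto intro!: derivative_eq_intros simp: divide_simps power2_eq_square) (simp add: algebra_simps)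

text \<open>This is the pullback of the forms. With D = 1 - z t and s the image of t, it rests on s
  = (1 - t)/D, 1 - s = (1 - z) t/D and 1 - z s = (1 - z)/D.\<close>

lemma form_involution:
  assumes "z \<noteq> 1" "t \<noteq> 0" "t \<noteq> 1" "1 - z * t \<noteq> 0"
  shows "form z (swap a) (involution z t) * (- (1 - z) / (1 - z * t)\<^sup>2) = - form z a t"
proof -
  define D where "D = 1 - z * t"
  have D: "D \<noteq> 0" "1 - t \<noteq> 0" "1 - z \<noteq> 0"
    using assms by (auto simp: D_def)
  have 1: "1 - involution z t = (1 - z) * t / D"
    using D by (simp add: involution_def flip: D_def) (simp add: D_def field_simps)
  have 2: "1 - z * involution z t = (1 - z) / D"
    using D by (simp add: involution_def flip: D_def) (simp add: D_def field_simps)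
  have 3: "1 / (1 - t) - z / D = (1 - z) / ((1 - t) * D)"
    using D by (simp add: divide_simps) (simp add: D_def algebra_simps)
  show ?thesis
  proof (cases a)
    case X
    have "D / ((1 - z) * t) - z * D / (1 - z) = D * D / ((1 - z) * t)"
      using D assms(2) by (simp add: divide_simps) (simp add: D_def algebra_simps)
    with X show ?thesis
      using D assms(2) by (simp add: 1 2 flip: D_def) (simp add: power2_eq_square divide_simps)
  next
    case Y0
    then show ?thesis
      using D by (simp add: 2 flip: D_def) (simp add: power2_eq_square divide_simps algebra_simps)
  next
    case Y1
    then show ?thesis
      using D by (simp add: 3 flip: D_def) (simp add: involution_def power2_eq_square minus_divide_left flip: D_def)
  qed
qed


text \<open>The reversal in \<tau> undoes the reversed encoding of words, so
  \<open>map swap (drop i w)\<close> stands for \<tau>(v). The conditions on the ends of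
  \<open>w\<close> keep the derivative formula away from the one-letter word X in both
  factors.\<close>

lemma sum_polylog_deconcatenation_constant:
  assumes z: "norm z < 1" and w: "w \<noteq> []" "hd w \<noteq> X" "last w \<noteq> Y1"
  obtains c where "\<And>t. 0 < t \<Longrightarrow> t < 1 \<Longrightarrow>
    (\<Sum>i\<le>length w. polylog z (rev (take i w)) (of_real t) *
       polylog z (map swap (drop i w)) (involution z (of_real t))) = c"
proof -
  define A where "A i = polylog z (rev (take i w))" for i
  define B where "B i = (\<lambda>t. polylog z (map swap (drop i w)) (involution z t))" for i
  define N where "N = length w"
  have deriv: "((\<lambda>t. \<Sum>i\<le>N. A i (of_real t) * B i (of_real t)) has_vector_derivative 0) (at t)"
    if t: "0 < t" "t < 1" for t :: real
  proof -
    let ?t = "of_real t :: complex"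
    define k where "k i = form z (w ! i) ?t" for i
    have denom: "1 - z * ?t \<noteq> 0"
      by (rule involution_denom_nonzero[OF z t])
    have z1: "z \<noteq> 1" and t0: "?t \<noteq> 0" and t1: "?t \<noteq> 1"
      using z t by auto
    have inv0: "involution z ?t \<noteq> 0"
      using t1 denom by (simp add: involution_def)
    have inv1: "norm (involution z ?t) < 1"
      by (rule norm_involution_less_1[OF z t])
    have A_0: "(A 0 has_field_derivative 0) (at ?t)"
      by (simp add: A_def)
    have A_Suc: "(A (Suc i) has_field_derivative k i * A i ?t) (at ?t)" if "i < N" for i
    proof -
      have "rev (take (Suc i) w) = w ! i # rev (take i w)"
        using that by (simp add: take_Suc_conv_app_nth N_def)
      moreover have "rev (take i w) \<noteq> []" if "w ! i = X"
        using that w by (cases i) (auto simp: hd_conv_nth)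
      ultimately show ?thesis
        using polylog_has_field_derivative[OF z, of ?t "w ! i" "rev (take i w)"] t
        by (simp add: A_def k_def)
    qed
    have B_N: "(B N has_field_derivative 0) (at ?t)"
      by (simp add: B_def N_def)
    have B_less: "(B i has_field_derivative - k i * B (Suc i) ?t) (at ?t)" if "i < N" for i
    proof -
      have drop: "map swap (drop i w) = swap (w ! i) # map swap (drop (Suc i) w)"
        using that by (simp add: Cons_nth_drop_Suc[symmetric] N_def)
      have "map swap (drop (Suc i) w) \<noteq> []" if "swap (w ! i) = X"
      proof -
        have "w ! i = Y1"
          using that by (cases "w ! i") auto
        then have "Suc i \<noteq> length w"
          using w by (metis diff_Suc_1 last_conv_nth)
        then show ?thesis
          using \<open>i < N\<close> by (simp add: N_def)
      qed
      then have "(polylog z (map swap (drop i w)) has_field_derivative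
          form z (swap (w ! i)) (involution z ?t) * polylog z (map swap (drop (Suc i) w)) (involution z ?t))
          (at (involution z ?t))"
        unfolding drop by (intro polylog_has_field_derivative z inv0 inv1)
      from DERIV_chain2[OF this involution_has_field_derivative[OF denom]]
      have "(B i has_field_derivative form z (swap (w ! i)) (involution z ?t) * B (Suc i) ?t *
          (- (1 - z) / (1 - z * ?t)\<^sup>2)) (at ?t)"
        by (simp add: B_def)
      also have "form z (swap (w ! i)) (involution z ?t) * B (Suc i) ?t * (- (1 - z) / (1 - z * ?t)\<^sup>2)
          = form z (swap (w ! i)) (involution z ?t) * (- (1 - z) / (1 - z * ?t)\<^sup>2) * B (Suc i) ?t"
        by (simp only: mult_ac)
      also have "\<dots> = - k i * B (Suc i) ?t"
        unfolding form_involution[OF z1 t0 t1 denom] k_def ..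
      finally show ?thesis .
    qed
    define A' where "A' i = (case i of 0 \<Rightarrow> 0 | Suc j \<Rightarrow> k j * A j ?t)" for i
    define B' where "B' i = (if i < N then - k i * B (Suc i) ?t else 0)" for i
    have "(A i has_field_derivative A' i) (at ?t)" "(B i has_field_derivative B' i) (at ?t)"
      if "i \<le> N" for i
      using that A_0 A_Suc B_N B_less by (auto simp: A'_def B'_def split: nat.split)
    then have "((\<lambda>s. \<Sum>i\<le>N. A i s * B i s) has_field_derivative
        (\<Sum>i\<le>N. A' i * B i ?t + B' i * A i ?t)) (at ?t)"
      by (intro DERIV_sum DERIV_mult) auto
    also have "(\<Sum>i\<le>N. A' i * B i ?t + B' i * A i ?t)
        = (\<Sum>i\<le>N. A' i * B i ?t) + (\<Sum>i\<le>N. B' i * A i ?t)"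
      by (rule sum.distrib)
    \<comment> \<open>After a shift by one, the derivative of the prefix in summand i + 1 meets that
      of the suffix in summand i, with the opposite sign.\<close>
    also have "(\<Sum>i\<le>N. A' i * B i ?t) = (\<Sum>i<N. k i * A i ?t * B (Suc i) ?t)"
      by (simp add: lessThan_Suc_atMost[symmetric] sum.lessThan_Suc_shift A'_def del: sum.lessThan_Suc)
    also have "(\<Sum>i\<le>N. B' i * A i ?t) = (\<Sum>i<N. - (k i * A i ?t * B (Suc i) ?t))"
      by (simp add: lessThan_Suc_atMost[symmetric] B'_def mult_ac)
    finally have "((\<lambda>s. \<Sum>i\<le>N. A i s * B i s) has_field_derivative 0) (at ?t)"
      by (simp add: sum_negf)
    then show ?thesis
      by (rule has_vector_derivative_real_field)
  qed
  have "\<exists>c. \<forall>t\<in>{0<..<1}. (\<Sum>i\<le>N. A i (of_real t) * B i (of_real t)) = c"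
    by (rule has_derivative_zero_constant)
      (use deriv in \<open>auto simp: has_vector_derivative_def intro: has_derivative_at_withinI\<close>)
  then obtain c where "\<And>t. t \<in> {0<..<1} \<Longrightarrow> (\<Sum>i\<le>N. A i (of_real t) * B i (of_real t)) = c"
    by blast
  then show ?thesis
    by (intro that) (simp add: A_def B_def N_def)
qed

lemma involution_tendsto: "((\<lambda>t. involution z (of_real t)) \<longlongrightarrow> 1) (at_right 0)"
  unfolding involution_def by (auto intro!: tendsto_eq_intros)

theorem polylog_duality:
  assumes z: "norm z < 1" and w: "w \<noteq> []" "hd w \<noteq> X" "last w \<noteq> Y1"
  shows "polylog z (rev w) 1 = polylog z (map swap w) 1"
proof -
  define \<Phi> where "\<Phi> t = (\<Sum>i\<le>length w. polylog z (rev (take i w)) (of_real t) *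
       polylog z (map swap (drop i w)) (involution z (of_real t)))" for t :: real
  obtain c where c: "\<And>t. 0 < t \<Longrightarrow> t < 1 \<Longrightarrow> \<Phi> t = c"
    unfolding \<Phi>_def using sum_polylog_deconcatenation_constant[OF z w] by blast
  let ?K = "1 / (1 - norm z)"
  have right: "\<forall>\<^sub>F t in at_right 0. 0 < t \<and> t < (1::real)"
    by (rule eventually_at_right_less[of 0, THEN eventually_elim2, OF eventually_at_rightI[of 0 1]]) auto
  have left: "\<forall>\<^sub>F t in at_left 1. 0 < t \<and> t < (1::real)"
    by (rule eventually_at_leftI[of 0]) auto

  \<comment> \<open>At t = 0 only the empty prefix survives: any other prefix series vanishes there
    and outweighs the growth of its partner at 1.\<close>
  have "(\<Phi> \<longlongrightarrow> (\<Sum>i\<le>length w. if i = 0 then polylog z (map swap w) 1 else 0)) (at_right 0)"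
    unfolding \<Phi>_def
  proof (rule tendsto_sum)
    fix i assume i: "i \<in> {..length w}"
    have p: "\<forall>\<^sub>F t in at_right 0. norm (involution z (of_real t)) < 1"
      using right by eventually_elim (use norm_involution_less_1[OF z] in auto)
    have q: "\<forall>\<^sub>F t in at_right 0. norm (complex_of_real t) \<le> ?K * (1 - norm (involution z (of_real t)))"
      using right by eventually_elim (use involution_bounds(2)[OF z] in auto)
    show "((\<lambda>t. polylog z (rev (take i w)) (of_real t) *
       polylog z (map swap (drop i w)) (involution z (of_real t))) \<longlongrightarrow>
       (if i = 0 then polylog z (map swap w) 1 else 0)) (at_right 0)"
    proof (cases "i = 0")
      case True
      have "hd (map swap w) \<noteq> Y1"
        using w by (cases "hd w") (auto simp: hd_map)
      then show ?thesis
        using polylog_tendsto[OF z _ involution_tendsto p] by (simp add: True)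
    next
      case False
      then have "rev (take i w) \<noteq> []"
        using w by simp
      from polylog_mult_tendsto_0[OF z this involution_tendsto p q, of "map swap (drop i w)"] show ?thesis
        using False by (simp add: mult.commute)
    qed
  qed
  then have "(\<Phi> \<longlongrightarrow> polylog z (map swap w) 1) (at_right 0)"
    by simp
  moreover have "(\<Phi> \<longlongrightarrow> c) (at_right 0)"
    by (rule tendsto_eventually) (use right c in \<open>auto elim: eventually_mono\<close>)
  ultimately have "polylog z (map swap w) 1 = c"
    using tendsto_unique trivial_limit_at_right_real by blast

  \<comment> \<open>At t = 1 the roles are exchanged, and only the empty suffix survives.\<close>
  have "(\<Phi> \<longlongrightarrow> (\<Sum>i\<le>length w. if i = length w then polylog z (rev w) 1 else 0)) (at_left 1)"
    unfolding \<Phi>_def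
  proof (rule tendsto_sum)
    fix i assume i: "i \<in> {..length w}"
    have p1: "(complex_of_real \<longlongrightarrow> 1) (at_left 1)"
      by (auto intro!: tendsto_eq_intros)
    have p: "\<forall>\<^sub>F t in at_left 1. norm (complex_of_real t) < 1"
      using left by eventually_elim auto
    have q: "\<forall>\<^sub>F t in at_left 1. norm (involution z (of_real t)) \<le> ?K * (1 - norm (complex_of_real t))"
      using left by eventually_elim (use involution_bounds(1)[OF z] in auto)
    show "((\<lambda>t. polylog z (rev (take i w)) (of_real t) *
       polylog z (map swap (drop i w)) (involution z (of_real t))) \<longlongrightarrow>
       (if i = length w then polylog z (rev w) 1 else 0)) (at_left 1)"
    proof (cases "i = length w")
      case True
      have "hd (rev w) \<noteq> Y1"
        using w by (simp add: hd_rev)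
      then show ?thesis
        using polylog_tendsto[OF z _ p1 p] by (simp add: True)
    next
      case False
      then have "map swap (drop i w) \<noteq> []"
        using i by simp
      from polylog_mult_tendsto_0[OF z this p1 p q] show ?thesis
        using False by simp
    qed
  qed
  then have "(\<Phi> \<longlongrightarrow> polylog z (rev w) 1) (at_left 1)"
    by simp
  moreover have "(\<Phi> \<longlongrightarrow> c) (at_left 1)"
    by (rule tendsto_eventually) (use left c in \<open>auto elim: eventually_mono\<close>)
  ultimately have "polylog z (rev w) 1 = c"
    using tendsto_unique trivial_limit_at_left_real by blast
  with \<open>polylog z (map swap w) 1 = c\<close> show ?thesis
    by simp
qed

section \<open>The dual index\<close>

primrec letter_poly :: "xy \<Rightarrow> nc_poly" where
  "letter_poly X = gen_x"
| "letter_poly Y0 = gen_y 0"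
| "letter_poly Y1 = gen_y 1"

definition word_poly :: "xy list \<Rightarrow> nc_poly"
  where "word_poly w = prod_list (map letter_poly w)"

lemma tau_word_poly: "tau (word_poly w) = word_poly (rev (map swap w))"
proof (induction w)
  case Nil
  show ?case
    using tau_scalar[of 1] by (simp add: word_poly_def)
next
  case (Cons a w)
  have "tau (letter_poly a) = letter_poly (swap a)"
    using tau_gen_y1 by (cases a) (simp_all add: tau_gen_x tau_gen_y0)
  with Cons show ?case
    by (simp add: word_poly_def tau_mult)
qed

lemma lookup_gen_mult:
  "Poly_Mapping.lookup (gen a * p) (Word l) =
    (case l of [] \<Rightarrow> 0 | b # l' \<Rightarrow> if a = b then Poly_Mapping.lookup p (Word l') else 0)"
proof (induction p rule: nc_poly_induct)
  case (single u c)
  show ?case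
    by (cases u)
      (auto simp: gen_def mult_single plus_free_word_def lookup_single when_def split: list.split)
qed (auto simp: distrib_left lookup_add split: list.split)

text \<open>The matrix of the substitution expressing x, y_0, y_1 through e_0, e_1, e_z.\<close>

fun letter_coeff :: "xy \<Rightarrow> letter \<Rightarrow> rat" where
  "letter_coeff X E0 = 1"
| "letter_coeff Y0 Ez = - 1"
| "letter_coeff Y1 Ez = 1"
| "letter_coeff Y1 E1 = - 1"
| "letter_coeff _ _ = 0"

lemma lookup_letter_poly_mult:
  "Poly_Mapping.lookup (letter_poly x * p) (Word l) =
    (case l of [] \<Rightarrow> 0 | b # l' \<Rightarrow> letter_coeff x b * Poly_Mapping.lookup p (Word l'))"
proof (cases l)
  case Nil
  then show ?thesis
    by (cases x) (simp_all add: gen_x_def gen_y_def left_diff_distrib lookup_minus lookup_gen_mult)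
next
  case (Cons b l')
  then show ?thesis
    by (cases x; cases b)
      (simp_all add: gen_x_def gen_y_def left_diff_distrib lookup_minus lookup_gen_mult)
qed

text \<open>A word arises in at most one way when the product is expanded, so its coefficient is a
  product of letter coefficients and nothing cancels.\<close>

lemma lookup_word_poly_nonzero_iff:
  "Poly_Mapping.lookup (word_poly w) (Word l) \<noteq> 0 \<longleftrightarrow> list_all2 (\<lambda>x b. letter_coeff x b \<noteq> 0) w l"
proof (induction w arbitrary: l)
  case Nil
  have "word_poly [] = Poly_Mapping.single 0 1"
    by (simp add: word_poly_def)
  then show ?case
    by (cases l) (simp_all add: lookup_single zero_free_word_def when_def)
next
  case (Cons a w)
  then show ?case
    by (cases l) (auto simp: word_poly_def lookup_letter_poly_mult)
qed

text \<open>The word obtained by picking \<open>e\<^sub>1\<close> from each \<open>y\<^sub>1 = e\<^sub>z - e\<^sub>1\<close> separates the products of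
  letters, although \<open>e\<^sub>z\<close> occurs in both \<open>y\<^sub>0\<close> and \<open>y\<^sub>1\<close>.\<close>

primrec marker :: "xy \<Rightarrow> letter" where
  "marker X = E0"
| "marker Y0 = Ez"
| "marker Y1 = E1"

text \<open>The marker word of each side occurs in the expansion of the other. One direction leaves
  an ambiguity, since Y1 also produces the marker \<open>Ez\<close> of Y0; but Y0 does not produce
  the marker \<open>E1\<close> of Y1.\<close>

lemma word_poly_inject: "word_poly v = word_poly w \<longleftrightarrow> v = w"
proof
  assume eq: "word_poly v = word_poly w"
  let ?R = "\<lambda>x b. letter_coeff x b \<noteq> 0"
  have "list_all2 ?R u (map marker u)" for u
  proof (induction u)
    case (Cons a u)
    then show ?case
      by (cases a) auto
  qed simp
  then have "list_all2 ?R v (map marker w)" "list_all2 ?R w (map marker v)"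
    by (metis eq lookup_word_poly_nonzero_iff)+
  then have "length v = length w" "\<And>i. i < length v \<Longrightarrow> ?R (v ! i) (marker (w ! i)) \<and> ?R (w ! i) (marker (v ! i))"
    by (auto simp: list_all2_conv_all_nth)
  moreover have "x = y" if "?R x (marker y) \<and> ?R y (marker x)" for x y
    using that by (cases x; cases y) auto
  ultimately show "v = w"
    by (intro nth_equalityI) blast+
qed simp

section \<open>Translation between indices and words\<close>

definition y_letter :: "nat \<Rightarrow> xy"
  where "y_letter \<mu> = (if \<mu> = 0 then Y0 else Y1)"

definition word_of_index :: "aug_index \<Rightarrow> xy list"
  where "word_of_index ks = concat (map (\<lambda>(k, \<mu>). y_letter \<mu> # replicate (k - 1) X) ks)"

text \<open>Each block is a letter with the maximal run of X after it. A leading X is read like Y1,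
  so this inverts \<open>word_of_index\<close> only on words that do not start with X.\<close>

function index_of_word :: "xy list \<Rightarrow> aug_index" where
  "index_of_word [] = []"
| "index_of_word (a # w) =
    (Suc (length (takeWhile ((=) X) w)), if a = Y0 then 0 else 1) # index_of_word (dropWhile ((=) X) w)"
  by pat_completeness auto
termination
  by (relation "inv_image less_than length") (auto simp: less_Suc_eq_le length_dropWhile_le)

lemma word_of_index_simps [simp]:
  "word_of_index [] = []"
  "word_of_index ((k, \<mu>) # ks) = y_letter \<mu> # replicate (k - 1) X @ word_of_index ks"
  "word_of_index (ks @ ls) = word_of_index ks @ word_of_index ls"
  by (simp_all add: word_of_index_def)

lemma y_letter_simps [simp]: "y_letter \<mu> \<noteq> X" "y_letter \<mu> = Y0 \<longleftrightarrow> \<mu> = 0" "y_letter \<mu> = Y1 \<longleftrightarrow> \<mu> \<noteq> 0"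
  by (simp_all add: y_letter_def)

lemma hd_word_of_index: "ks \<noteq> [] \<Longrightarrow> word_of_index ks \<noteq> [] \<and> hd (word_of_index ks) \<noteq> X"
  by (cases ks) auto

lemma index_of_word_of_index: "is_aug_index ks \<Longrightarrow> index_of_word (word_of_index ks) = ks"
proof (induction ks)
  case (Cons k\<mu> ks)
  obtain k \<mu> where k\<mu>: "k\<mu> = (k, \<mu>)"
    by fastforce
  have "takeWhile ((=) X) (word_of_index ks) = []" "dropWhile ((=) X) (word_of_index ks) = word_of_index ks"
    using hd_word_of_index[of ks] by (cases "word_of_index ks"; cases ks; force)+
  with Cons show ?case
    by (auto simp: k\<mu> is_aug_index_def takeWhile_append dropWhile_append)
qed simp

lemma word_of_index_of_word: "w = [] \<or> hd w \<noteq> X \<Longrightarrow> word_of_index (index_of_word w) = w"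
proof (induction w rule: index_of_word.induct)
  case (2 a w)
  have "dropWhile ((=) X) w = [] \<or> hd (dropWhile ((=) X) w) \<noteq> X"
    using hd_dropWhile[of "(=) X" w] by metis
  moreover have "replicate (length (takeWhile ((=) X) w)) X = takeWhile ((=) X) w"
    by (rule sym, rule replicate_eqI) (auto dest: set_takeWhileD)
  moreover have "y_letter (if a = Y0 then 0 else 1) = a"
    using 2 by (cases a) (auto simp: y_letter_def)
  ultimately show ?case
    using 2 by simp
qed simp

lemma is_aug_index_index_of_word: "is_aug_index (index_of_word w)"
  by (induction w rule: index_of_word.induct) (auto simp: is_aug_index_def)

text \<open>A block with k > 1 ends in X, so a final Y1 can only come from a last entry (1,
  1).\<close>

lemma admissible_iff_last_word:
  assumes "is_aug_index ks"
  shows "admissible ks \<longleftrightarrow> word_of_index ks = [] \<or> last (word_of_index ks) \<noteq> Y1"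
proof (cases ks rule: rev_cases)
  case (snoc ls k\<mu>)
  then show ?thesis
    using assms by (cases k\<mu>) (auto simp: admissible_def is_aug_index_def)
qed (simp add: admissible_def is_aug_index_def)

lemma index_word_eq: "is_aug_index ks \<Longrightarrow> index_word ks = word_poly (word_of_index ks)"
proof (induction ks)
  case (Cons k\<mu> ks)
  obtain k \<mu> where k\<mu>: "k\<mu> = (k, \<mu>)"
    by fastforce
  have "letter_poly (y_letter \<mu>) = gen_y \<mu>"
    using Cons by (auto simp: k\<mu> is_aug_index_def y_letter_def)
  moreover have "prod_list (map letter_poly (replicate n X)) = gen_x ^ n" for n
    by (induction n) auto
  ultimately show ?case
    using Cons by (simp add: k\<mu> index_word_def word_poly_def is_aug_index_def mult.assoc)
qed (simp add: index_word_def word_poly_def)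

text \<open>Existence and uniqueness are both due, as \<open>dual_index\<close> is a definite
  description. Reversal with \<open>swap\<close> turns a final Y1 into an initial X and conversely,
  so the two excluded patterns are interchanged.\<close>

lemma word_of_dual_index:
  assumes "admissible ks"
  shows "admissible (dual_index ks)"
    and "word_of_index (dual_index ks) = rev (map swap (word_of_index ks))"
proof -
  define w where "w = rev (map swap (word_of_index ks))"
  have ks: "is_aug_index ks"
    using assms by (simp add: admissible_def)
  have *: "word_of_index ks = [] \<or> (hd (word_of_index ks) \<noteq> X \<and> last (word_of_index ks) \<noteq> Y1)"
    using assms admissible_iff_last_word[OF ks] hd_word_of_index[of ks] by (cases ks) auto
  have "w = [] \<or> hd w \<noteq> X"
    using * by (cases "last (word_of_index ks)") (auto simp: w_def hd_rev last_map)
  then have word: "word_of_index (index_of_word w) = w"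
    by (rule word_of_index_of_word)
  have "w = [] \<or> last w \<noteq> Y1"
    using * by (cases "hd (word_of_index ks)") (auto simp: w_def last_rev hd_map)
  then have adm: "admissible (index_of_word w)"
    by (simp add: admissible_iff_last_word is_aug_index_index_of_word word)
  have "dual_index ks = index_of_word w"
    unfolding dual_index_def
  proof (rule the_equality)
    show "admissible (index_of_word w) \<and> tau (index_word ks) = index_word (index_of_word w)"
      using adm by (simp add: index_word_eq ks is_aug_index_index_of_word word tau_word_poly flip: w_def)
    fix ls assume ls: "admissible ls \<and> tau (index_word ks) = index_word ls"
    then have "is_aug_index ls"
      by (simp add: admissible_def)
    moreover from this have "word_of_index ls = w"
      using ls by (simp add: index_word_eq ks tau_word_poly word_poly_inject w_def)
    ultimately show "ls = index_of_word w"
      using index_of_word_of_index by metis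
  qed
  with adm word show "admissible (dual_index ks)"
      "word_of_index (dual_index ks) = rev (map swap (word_of_index ks))"
    by (simp_all add: w_def)
qed

section \<open>The sum over tuples\<close>

text \<open>Generic in the weight, like \<open>coef\<close>, so that one computation serves both the
  sum and the sum of norms.\<close>

definition summand :: "(xy \<Rightarrow> nat \<Rightarrow> 'a::real_normed_field) \<Rightarrow> aug_index \<Rightarrow> nat list \<Rightarrow> 'a"
  where "summand \<phi> ks ms = (\<Prod>i<length ks.
    \<phi> (y_letter (snd (ks ! i))) ((0 # ms) ! Suc i - (0 # ms) ! i)
      / of_nat ((0 # ms) ! Suc i) ^ fst (ks ! i))"

text \<open>The prepended 0 makes the empty tuple end in 0, in accordance with
  \<open>coef \<phi> [] 0 = 1\<close>.\<close>

definition tuples_ending_in :: "nat \<Rightarrow> nat \<Rightarrow> nat list set"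
  where "tuples_ending_in r m = {ms \<in> summation_tuples r. last (0 # ms) = m}"

lemma tuples_ending_in_0: "tuples_ending_in 0 m = (if m = 0 then {[]} else {})"
  by (auto simp: tuples_ending_in_def summation_tuples_def)

lemma tuples_ending_in_Suc:
  "tuples_ending_in (Suc r) m = (\<lambda>ns. ns @ [m]) ` (\<Union>j<m. tuples_ending_in r j)"
proof (intro equalityI subsetI)
  fix ms assume ms: "ms \<in> tuples_ending_in (Suc r) m"
  then have "ms \<noteq> []"
    by (auto simp: tuples_ending_in_def summation_tuples_def)
  then obtain ns where ns: "ms = ns @ [m]"
    using ms by (cases ms rule: rev_cases) (auto simp: tuples_ending_in_def)
  have "length ns = r" and sorted: "sorted_wrt (<) ((0 # ns) @ [m])"
    using ms by (auto simp: ns tuples_ending_in_def summation_tuples_def)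
  moreover have "\<forall>x\<in>set (0 # ns). x < m" and "sorted_wrt (<) (0 # ns)"
    using sorted unfolding sorted_wrt_append by simp_all
  moreover from this(1) have "last (0 # ns) < m"
    by (rule bspec) (rule last_in_set, simp)
  ultimately have "ns \<in> tuples_ending_in r (last (0 # ns))" "last (0 # ns) < m"
    by (auto simp: tuples_ending_in_def summation_tuples_def)
  then show "ms \<in> (\<lambda>ns. ns @ [m]) ` (\<Union>j<m. tuples_ending_in r j)"
    by (auto simp: ns)
next
  fix ms assume "ms \<in> (\<lambda>ns. ns @ [m]) ` (\<Union>j<m. tuples_ending_in r j)"
  then obtain ns where ns: "ms = ns @ [m]" "last (0 # ns) < m" "length ns = r" "sorted_wrt (<) (0 # ns)"
    by (auto simp: tuples_ending_in_def summation_tuples_def)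
  have "x \<le> last (0 # ns)" if "x \<in> set (0 # ns)" for x
  proof -
    have "sorted (0 # ns)"
      using ns(4) strict_sorted_imp_sorted by blast
    then show ?thesis
      using that by (metis append_butlast_last_id in_set_conv_decomp le_refl list.distinct(1) set_ConsD
          sorted_append rotate1.simps(2) set_rotate1)
  qed
  then have "sorted_wrt (<) ((0 # ns) @ [m])"
    using ns unfolding sorted_wrt_append by force
  then show "ms \<in> tuples_ending_in (Suc r) m"
    using ns by (auto simp: tuples_ending_in_def summation_tuples_def)
qed

lemma finite_tuples_ending_in: "finite (tuples_ending_in r m)"
  by (induction r arbitrary: m) (auto simp: tuples_ending_in_0 tuples_ending_in_Suc)

lemma summand_snoc:
  assumes "length ns = length ks"
  shows "summand \<phi> (ks @ [(k, \<mu>)]) (ns @ [m]) =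
    summand \<phi> ks ns * (\<phi> (y_letter \<mu>) (m - last (0 # ns)) / of_nat m ^ k)"
proof -
  have "(0 # ns @ [m]) ! i = (0 # ns) ! i" if "i \<le> length ks" for i
    using assms that nth_append[of "0 # ns" "[m]" i] by simp
  moreover from this have "(0 # ns @ [m]) ! length ks = last (0 # ns)"
    using assms last_conv_nth[of "0 # ns"] by simp
  ultimately show ?thesis
    using assms by (simp add: summand_def nth_append)
qed

lemma coef_replicate_X: "coef \<phi> (replicate n X @ w) m = coef \<phi> w m / of_nat m ^ n"
  by (induction n) (auto simp: mult.commute)

text \<open>Removing the last entry of tuple and index reproduces the recursion of
  \<open>coef\<close>: the sum over the preceding entry j < m is the convolution for the y-letter,
  and the k divisions by m come from that letter and its k - 1 letters X.\<close>

lemma sum_summand_eq_coef: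
  assumes "is_aug_index ks"
  shows "(\<Sum>ms\<in>tuples_ending_in (length ks) m. summand \<phi> ks ms) = coef \<phi> (rev (word_of_index ks)) m"
  using assms
proof (induction ks arbitrary: m rule: rev_induct)
  case Nil
  then show ?case
    by (simp add: tuples_ending_in_0 summand_def)
next
  case (snoc k\<mu> ks)
  obtain k \<mu> where k\<mu>: "k\<mu> = (k, \<mu>)"
    by fastforce
  have ks: "is_aug_index ks" and k: "k > 0"
    using snoc.prems by (auto simp: k\<mu> is_aug_index_def)
  let ?y = "y_letter \<mu>"
  have disj: "tuples_ending_in r i \<inter> tuples_ending_in r j = {}" if "i \<noteq> j" for r i j
    using that by (auto simp: tuples_ending_in_def)
  have "(\<Sum>ms\<in>tuples_ending_in (length (ks @ [k\<mu>])) m. summand \<phi> (ks @ [k\<mu>]) ms)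
      = (\<Sum>ns\<in>(\<Union>j<m. tuples_ending_in (length ks) j). summand \<phi> (ks @ [k\<mu>]) (ns @ [m]))"
    by (simp add: tuples_ending_in_Suc sum.reindex inj_on_def)
  also have "\<dots> = (\<Sum>j<m. \<Sum>ns\<in>tuples_ending_in (length ks) j. summand \<phi> (ks @ [k\<mu>]) (ns @ [m]))"
    by (rule sum.UNION_disjoint) (auto simp: finite_tuples_ending_in disj)
  also have "\<dots> = (\<Sum>j<m. \<Sum>ns\<in>tuples_ending_in (length ks) j.
      summand \<phi> ks ns * (\<phi> ?y (m - j) / of_nat m ^ k))"
    by (intro sum.cong refl)
      (auto simp: k\<mu> summand_snoc tuples_ending_in_def summation_tuples_def simp del: last.simps)
  also have "\<dots> = (\<Sum>j<m. coef \<phi> (rev (word_of_index ks)) j * (\<phi> ?y (m - j) / of_nat m ^ k))"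
    by (simp only: snoc.IH[OF ks] flip: sum_distrib_right)
  also have "\<dots> = coef \<phi> (rev (word_of_index (ks @ [k\<mu>]))) m"
    using k by (cases k) (simp_all add: k\<mu> coef_replicate_X sum_divide_distrib)
  finally show ?case .
qed

text \<open>The unordered sum is regrouped by the last entry m of the tuple. Fibres are finite, and
  their sums of norms are \<open>abs_coef\<close>, whose summability justifies the
  regrouping.\<close>

lemma Li_tilde_eq_polylog:
  assumes ks: "admissible ks" and z: "norm z < 1"
  shows "Li_tilde ks z = polylog z (rev (word_of_index ks)) 1"
proof -
  define r w where "r = length ks" and "w = rev (word_of_index ks)"
  have aug: "is_aug_index ks"
    using ks by (simp add: admissible_def)
  then have "w = [] \<or> hd w \<noteq> Y1"
    using ks by (auto simp: w_def admissible_iff_last_word hd_rev)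
  then have abs_summable: "summable (abs_coef z w)"
    by (rule summable_abs_coef[OF z])
  let ?P = "summand (weight z) ks"
  have norm_P: "norm (?P ms) = summand (\<lambda>a k. norm (weight z a k)) ks ms" for ms
    by (simp add: summand_def norm_divide norm_power flip: prod_norm)
  have fibre: "(?P has_sum coef (weight z) w m) (tuples_ending_in r m)" for m
    using has_sum_finite[OF finite_tuples_ending_in[of r m], of ?P]
    by (simp add: sum_summand_eq_coef[OF aug] r_def w_def)
  have norm_fibre: "((\<lambda>ms. norm (?P ms)) has_sum abs_coef z w m) (tuples_ending_in r m)" for m
    using has_sum_finite[OF finite_tuples_ending_in[of r m], of "\<lambda>ms. norm (?P ms)"]
    by (simp add: norm_P sum_summand_eq_coef[OF aug] r_def w_def abs_coef_def)
  have "(\<lambda>x. norm (?P (snd x))) summable_on (SIGMA m:UNIV. tuples_ending_in r m)"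
    by (rule summable_on_SigmaI[where g = "abs_coef z w"])
      (use norm_fibre abs_summable abs_coef_nonneg in \<open>auto simp: summable_on_UNIV_nonneg_real_iff\<close>)
  then have summable: "(\<lambda>x. ?P (snd x)) summable_on (SIGMA m:UNIV. tuples_ending_in r m)"
    by (rule abs_summable_summable)
  have "summable (\<lambda>m. norm (coef (weight z) w m))"
    by (rule summable_comparison_test'[OF abs_summable]) (use norm_coef_le in auto)
  then have "(coef (weight z) w has_sum polylog z w 1) UNIV"
    by (intro norm_summable_imp_has_sum)
      (auto simp: polylog_def dest: summable_norm_cancel intro: summable_sums)
  then have "((\<lambda>x. ?P (snd x)) has_sum polylog z w 1) (SIGMA m:UNIV. tuples_ending_in r m)"
    using fibre by (intro has_sum_SigmaI[OF _ _ summable]) auto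
  also have "?this \<longleftrightarrow> (?P has_sum polylog z w 1) (summation_tuples r)"
    by (rule has_sum_reindex_bij_witness[of _ "\<lambda>ms. (last (0 # ms), ms)" snd])
      (auto simp: tuples_ending_in_def)
  finally have "infsum ?P (summation_tuples r) = polylog z w 1"
    by (rule infsumI)
  moreover have "(\<Prod>i<length ks. (of_nat (snd (ks ! i)) + (- 1) ^ snd (ks ! i) * z ^ ((0 # ms) ! Suc i - (0 # ms) ! i))
           / of_nat ((0 # ms) ! Suc i) ^ fst (ks ! i)) = ?P ms" for ms
    unfolding summand_def
  proof (intro prod.cong refl arg_cong2[where f = "(/)"])
    fix i assume "i \<in> {..<length ks}"
    then have "ks ! i \<in> set ks"
      by simp
    then have "case ks ! i of (k, \<mu>) \<Rightarrow> k > 0 \<and> \<mu> \<in> {0, 1}"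
      using aug unfolding is_aug_index_def by (rule bspec[rotated])
    then have "snd (ks ! i) = 0 \<or> snd (ks ! i) = 1"
      by (cases "ks ! i") simp
    then show "of_nat (snd (ks ! i)) + (- 1) ^ snd (ks ! i) * z ^ ((0 # ms) ! Suc i - (0 # ms) ! i) =
        weight z (y_letter (snd (ks ! i))) ((0 # ms) ! Suc i - (0 # ms) ! i)"
      by (auto simp: y_letter_def)
  qed
  ultimately show ?thesis
    by (simp add: Li_tilde_def r_def w_def)
qed

theorem theorem1p3:
  fixes ks :: aug_index and z :: complex
  assumes "admissible ks" and "norm z < 1"
  shows "Li_tilde ks z = Li_tilde (dual_index ks) z"
proof -
  let ?w = "word_of_index ks"
  have "polylog z (rev ?w) 1 = polylog z (map swap ?w) 1"
  proof (cases "ks = []")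
    case False
    then have "?w \<noteq> []" "hd ?w \<noteq> X"
      using hd_word_of_index by auto
    moreover from this have "last ?w \<noteq> Y1"
      using assms(1) admissible_iff_last_word by (auto simp: admissible_def)
    ultimately show ?thesis
      by (rule polylog_duality[OF assms(2)])
  qed simp
  \<comment> \<open>The dual word is \<open>rev (map swap ?w)\<close>, and the reversal in the
    encoding turns it back into \<open>map swap ?w\<close>.\<close>
  then show ?thesis
    using word_of_dual_index[OF assms(1)] assms by (simp add: Li_tilde_eq_polylog)
qed

end
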